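(* Let $(\Omega,\mathcal F,\mathbb P)$ be a standard probability space, $\theta:\Omega\to\Omega$ an invertible, bimeasurable, measure-preserving transformation, $H$ a real separable Hilbert space, and $\mathscr H=L^2(\Omega;H)$. Let $S\subset\mathbb Z$ be finite and $F_S=\{0\}\cup S\cup(S+S)$. Assume $\mathbb P\{\omega:\theta^a\omega=\theta^b\omega\}=0$ for all $a\ne b$ in $F_S$. Let $T:\mathscr H\to\mathscr H$ be a finite $S$-memory map with $T=\nabla\Psi$ for some $\Psi\in C^1(\mathscr H)$ (real-valued, on all of $\mathscr H$), and suppose $$S\cap(-S)\subset\{0\}.$$ Then every nonzero lag $k\in S$ is inactive. In particular, for $S=\{0,1,\dots,m\}$ with $\mathbb P\{\omega:\theta^a\omega=\theta^b\omega\}=0$ for all $a\neq b$ in $\{0,1,\dots,2m\}$, there is a measurable map $(\omega,z)\mapsto s_\omega(z)$ from $\Omega\times H$ to $H$ such that for every $u\in\mathscr H$ $$(Tu)(\omega)=s_\omega(u(\omega))\qquad\text{for a.e. }\omega.$$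
   Context: A continuous map $T:\mathscr H\to\mathscr H$ is a finite $S$-memory map if it admits a Carathéodory representation $(Tu)(\omega)=t_\omega\bigl((u(\theta^s\omega))_{s\in S}\bigr)$ (a.e. $\omega$, for every $u\in\mathscr H$), where $t_\omega:H^S\to H$ is continuous for a.e. $\omega$ and $\omega\mapsto t_\omega(z)$ is measurable for each fixed $z\in H^S$. For $k\in S$, the $k$th lag is inactive if, outside one null set of $\omega$, $t_\omega$ is independent of its $k$th coordinate; otherwise it is active. $S+S=\{s+t:s,t\in S\}$ and $-S=\{-s:s\in S\}$. *)

theory Defs
  imports "HOL-Probability.Probability"
begin

definition standard_borel :: "'a measure \<Rightarrow> bool" where
  "standard_borel M \<longleftrightarrow>
     (\<exists>X. topspace X = space M \<and> completely_metrizable_space X \<and> second_countable X \<and>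
          sets M = sigma_sets (space M) {U. openin X U})"

(* Both usual conventions are covered: a Borel probability on a standard Borel space,
   and the completion of one (Lebesgue-Rokhlin space). *)
definition standard_prob_space :: "'a measure \<Rightarrow> bool" where
  "standard_prob_space M \<longleftrightarrow>
     prob_space M \<and> (standard_borel M \<or> (\<exists>N. standard_borel N \<and> M = completion N))"

definition mp_automorphism :: "'a measure \<Rightarrow> ('a \<Rightarrow> 'a) \<Rightarrow> bool" where
  "mp_automorphism M \<theta> \<longleftrightarrow>
     bij_betw \<theta> (space M) (space M) \<and> \<theta> \<in> M \<rightarrow>\<^sub>M M \<and>
     inv_into (space M) \<theta> \<in> M \<rightarrow>\<^sub>M M \<and> distr M M \<theta> = M"

definition int_iterate :: "'a measure \<Rightarrow> ('a \<Rightarrow> 'a) \<Rightarrow> int \<Rightarrow> 'a \<Rightarrow> 'a" where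
  "int_iterate M \<theta> n =
     (if n \<ge> 0 then \<theta> ^^ nat n else inv_into (space M) \<theta> ^^ nat (- n))"

definition ae_distinct_iterates :: "'a measure \<Rightarrow> ('a \<Rightarrow> 'a) \<Rightarrow> int set \<Rightarrow> bool" where
  "ae_distinct_iterates M \<theta> F \<longleftrightarrow>
     (\<forall>a\<in>F. \<forall>b\<in>F. a \<noteq> b \<longrightarrow> (AE \<omega> in M. int_iterate M \<theta> a \<omega> \<noteq> int_iterate M \<theta> b \<omega>))"

(* Elements of the Hilbert space of square-integrable functions are handled through
   representatives; maps and functionals on it are required to respect a.e. equality. *)
definition L2 :: "'a measure \<Rightarrow> ('a \<Rightarrow> 'h::{real_inner,banach,second_countable_topology}) set" where
  "L2 M = {u \<in> borel_measurable M. integrable M (\<lambda>\<omega>. (norm (u \<omega>))\<^sup>2)}"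

definition L2_inner ::
  "'a measure \<Rightarrow> ('a \<Rightarrow> 'h::{real_inner,banach,second_countable_topology}) \<Rightarrow> ('a \<Rightarrow> 'h) \<Rightarrow> real" where
  "L2_inner M u v = (\<integral>\<omega>. u \<omega> \<bullet> v \<omega> \<partial>M)"

definition L2_norm ::
  "'a measure \<Rightarrow> ('a \<Rightarrow> 'h::{real_inner,banach,second_countable_topology}) \<Rightarrow> real" where
  "L2_norm M u = sqrt (L2_inner M u u)"

definition L2_map ::
  "'a measure \<Rightarrow> (('a \<Rightarrow> 'h::{real_inner,banach,second_countable_topology}) \<Rightarrow> ('a \<Rightarrow> 'h)) \<Rightarrow> bool" where
  "L2_map M T \<longleftrightarrow>
     (\<forall>u\<in>L2 M. T u \<in> L2 M) \<and>
     (\<forall>u\<in>L2 M. \<forall>v\<in>L2 M. (AE \<omega> in M. u \<omega> = v \<omega>) \<longrightarrow> (AE \<omega> in M. T u \<omega> = T v \<omega>))"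

definition L2_functional ::
  "'a measure \<Rightarrow> (('a \<Rightarrow> 'h::{real_inner,banach,second_countable_topology}) \<Rightarrow> real) \<Rightarrow> bool" where
  "L2_functional M \<Psi> \<longleftrightarrow>
     (\<forall>u\<in>L2 M. \<forall>v\<in>L2 M. (AE \<omega> in M. u \<omega> = v \<omega>) \<longrightarrow> \<Psi> u = \<Psi> v)"

definition L2_continuous_map ::
  "'a measure \<Rightarrow> (('a \<Rightarrow> 'h::{real_inner,banach,second_countable_topology}) \<Rightarrow> ('a \<Rightarrow> 'h)) \<Rightarrow> bool" where
  "L2_continuous_map M T \<longleftrightarrow>
     L2_map M T \<and>
     (\<forall>u\<in>L2 M. \<forall>e>0. \<exists>d>0. \<forall>v\<in>L2 M.
        L2_norm M (\<lambda>\<omega>. v \<omega> - u \<omega>) < d \<longrightarrow> L2_norm M (\<lambda>\<omega>. T v \<omega> - T u \<omega>) < e)"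

(* G u is the Riesz representative of the Frechet derivative of \<Psi> at u. *)
definition L2_has_gradient ::
  "'a measure \<Rightarrow> (('a \<Rightarrow> 'h::{real_inner,banach,second_countable_topology}) \<Rightarrow> real)
    \<Rightarrow> (('a \<Rightarrow> 'h) \<Rightarrow> ('a \<Rightarrow> 'h)) \<Rightarrow> bool" where
  "L2_has_gradient M \<Psi> G \<longleftrightarrow>
     L2_functional M \<Psi> \<and> L2_map M G \<and>
     (\<forall>u\<in>L2 M. \<forall>e>0. \<exists>d>0. \<forall>v\<in>L2 M. L2_norm M (\<lambda>\<omega>. v \<omega> - u \<omega>) < d \<longrightarrow>
        \<bar>\<Psi> v - \<Psi> u - L2_inner M (G u) (\<lambda>\<omega>. v \<omega> - u \<omega>)\<bar> \<le> e * L2_norm M (\<lambda>\<omega>. v \<omega> - u \<omega>))"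

definition L2_C1 ::
  "'a measure \<Rightarrow> (('a \<Rightarrow> 'h::{real_inner,banach,second_countable_topology}) \<Rightarrow> real) \<Rightarrow> bool" where
  "L2_C1 M \<Psi> \<longleftrightarrow> (\<exists>G. L2_continuous_map M G \<and> L2_has_gradient M \<Psi> G)"

(* The power of H indexed by S is the set of extensional functions on S, with the product topology. *)
definition caratheodory_representation ::
  "'a measure \<Rightarrow> ('a \<Rightarrow> 'a) \<Rightarrow> int set
    \<Rightarrow> (('a \<Rightarrow> 'h::{real_inner,banach,second_countable_topology}) \<Rightarrow> ('a \<Rightarrow> 'h))
    \<Rightarrow> ('a \<Rightarrow> (int \<Rightarrow> 'h) \<Rightarrow> 'h) \<Rightarrow> bool" where
  "caratheodory_representation M \<theta> S T t \<longleftrightarrow>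
     (AE \<omega> in M. continuous_map (product_topology (\<lambda>_. euclidean) S) euclidean (t \<omega>)) \<and>
     (\<forall>z \<in> S \<rightarrow>\<^sub>E UNIV. (\<lambda>\<omega>. t \<omega> z) \<in> borel_measurable M) \<and>
     (\<forall>u\<in>L2 M. AE \<omega> in M. T u \<omega> = t \<omega> (\<lambda>s\<in>S. u (int_iterate M \<theta> s \<omega>)))"

definition finite_memory_map ::
  "'a measure \<Rightarrow> ('a \<Rightarrow> 'a) \<Rightarrow> int set
    \<Rightarrow> (('a \<Rightarrow> 'h::{real_inner,banach,second_countable_topology}) \<Rightarrow> ('a \<Rightarrow> 'h)) \<Rightarrow> bool" where
  "finite_memory_map M \<theta> S T \<longleftrightarrow>
     finite S \<and> L2_continuous_map M T \<and> (\<exists>t. caratheodory_representation M \<theta> S T t)"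

definition inactive_lag ::
  "'a measure \<Rightarrow> int set \<Rightarrow> ('a \<Rightarrow> (int \<Rightarrow> 'h) \<Rightarrow> 'h) \<Rightarrow> int \<Rightarrow> bool" where
  "inactive_lag M S t k \<longleftrightarrow>
     (AE \<omega> in M. \<forall>z \<in> S \<rightarrow>\<^sub>E UNIV. \<forall>h. t \<omega> (z(k := h)) = t \<omega> z)"

definition memory_iterates :: "int set \<Rightarrow> int set" where
  "memory_iterates S = {0} \<union> S \<union> {s + t | s t. s \<in> S \<and> t \<in> S}"

end

theory Submission
  imports Defs
begin

text \<open>The derivative of a gradient map is formally symmetric: if the output at \<open>\<omega>\<close> responds to the input
  at \<open>\<theta>\<^sup>k \<omega>\<close>, then the output at \<open>\<theta>\<^sup>k \<omega>\<close> responds to the input at \<open>\<omega>\<close>, which is the lag \<open>-k\<close>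
  seen from \<open>\<theta>\<^sup>k \<omega>\<close>. So an active lag \<open>k \<noteq> 0\<close> would need \<open>-k \<in> S\<close>.

  The map is only continuous, and the symmetry is used in integrated form. If \<open>T = \<nabla>\<Psi>\<close>
  and adding multiples of \<open>g\<close> to the input never changes \<open>T\<close> where \<open>h\<close> is supported, then
  \<open>\<Psi>(u + h + \<epsilon>g) - \<Psi>(u + \<epsilon>g)\<close> does not depend on \<open>\<epsilon>\<close>. Differentiating at \<open>\<epsilon> = 0\<close> shows that
  \<open>T(u + h) - T u\<close> is orthogonal to \<open>g\<close> (\<open>gradient_increment_orthogonal\<close>).

  To isolate a single pair of sites, take a set \<open>A\<close> whose iterates \<open>\<theta>\<^sup>a A\<close>, for \<open>a\<close> in
  \<open>{0} \<union> S \<union> (S + S)\<close>, are pairwise disjoint, let \<open>h\<close> live on \<open>\<theta>\<^sup>k A\<close>, and let \<open>g\<close> be the restriction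
  of \<open>T(u + h) - T u\<close> to \<open>A\<close>. At a point of \<open>\<theta>\<^sup>k A\<close> the sites seen by \<open>T\<close> lie in the sets
  \<open>\<theta>\<^sup>s\<^sup>+\<^sup>k A\<close>, none of which meets \<open>A\<close>, because \<open>s + k = 0\<close> is excluded. Hence \<open>g\<close> is orthogonal to itself and
  \<open>T(u + h) = T u\<close> on \<open>A\<close>. Disjointness also allows \<open>u\<close> to prescribe arbitrary values on the sets \<open>\<theta>\<^sup>s A\<close>,
  so the equation says that \<open>t\<^sub>\<omega>\<close> ignores its \<open>k\<close>th coordinate at one given point
  (\<open>lag_independence_on_disjoint_iterates\<close>). Countably many sets \<open>A\<close> cover almost all of the space
  (\<open>countable_cover_disjoint_iterates\<close>), and by continuity of \<open>t\<^sub>\<omega>\<close> countably many points suffice.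

  For \<open>S = {0,\<dots>,m}\<close>, setting all coordinates with nonzero index to \<open>0\<close> turns \<open>t\<^sub>\<omega>\<close> into a function of
  the coordinate with index \<open>0\<close> that is measurable in \<open>\<omega>\<close> and continuous in \<open>z\<close>, hence jointly measurable.\<close>

section \<open>Iterates of an automorphism\<close>

lemma measurable_funpow:
  assumes "f \<in> M \<rightarrow>\<^sub>M M"
  shows "f ^^ j \<in> M \<rightarrow>\<^sub>M M"
proof (induction j)
  case (Suc j)
  then show ?case using measurable_comp[OF Suc assms] by (simp add: o_def)
qed (simp add: id_def)

lemma measurable_int_iterate:
  assumes "mp_automorphism M \<theta>"
  shows "int_iterate M \<theta> n \<in> M \<rightarrow>\<^sub>M M"
  using assms by (auto simp: int_iterate_def mp_automorphism_def intro: measurable_funpow)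

lemma int_iterate_succ:
  assumes "mp_automorphism M \<theta>" "\<omega> \<in> space M"
  shows "int_iterate M \<theta> (n + 1) \<omega> = \<theta> (int_iterate M \<theta> n \<omega>)"
proof (cases "n \<ge> 0")
  case True
  then show ?thesis
    by (simp add: int_iterate_def nat_add_distrib)
next
  case False
  define j where "j = nat (- n - 1)"
  have n: "n = - int (Suc j)" using False by (simp add: j_def)
  have "inv_into (space M) \<theta> ^^ j \<in> M \<rightarrow>\<^sub>M M"
    using assms(1) by (intro measurable_funpow) (simp add: mp_automorphism_def)
  then have "(inv_into (space M) \<theta> ^^ j) \<omega> \<in> \<theta> ` space M"
    using assms by (auto simp: mp_automorphism_def bij_betw_def dest: measurable_space)
  then have "\<theta> (inv_into (space M) \<theta> ((inv_into (space M) \<theta> ^^ j) \<omega>))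
               = (inv_into (space M) \<theta> ^^ j) \<omega>"
    by (rule f_inv_into_f)
  then show ?thesis
    unfolding n by (cases j) (auto simp: int_iterate_def nat_add_distrib)
qed

lemma int_iterate_add:
  assumes "mp_automorphism M \<theta>" "\<omega> \<in> space M"
  shows "int_iterate M \<theta> (a + b) \<omega> = int_iterate M \<theta> a (int_iterate M \<theta> b \<omega>)"
proof -
  have sp: "int_iterate M \<theta> n x \<in> space M" if "x \<in> space M" for n x
    using measurable_space[OF measurable_int_iterate[OF assms(1)] that] .
  show ?thesis
  proof (induction a rule: int_induct[where k = 0])
    case base
    show ?case by (simp add: int_iterate_def)
  next
    case (step1 i)
    have "int_iterate M \<theta> (i + 1 + b) \<omega> = \<theta> (int_iterate M \<theta> (i + b) \<omega>)"
      using int_iterate_succ[OF assms, of "i + b"] by (simp add: algebra_simps)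
    then show ?case
      using int_iterate_succ[OF assms(1) sp[OF assms(2)], of i b] step1 by simp
  next
    case (step2 i)
    \<comment> \<open>both sides have the same image under the injective map \<open>\<theta>\<close>\<close>
    have "\<theta> (int_iterate M \<theta> (i - 1 + b) \<omega>) = int_iterate M \<theta> (i + b) \<omega>"
      using int_iterate_succ[OF assms, of "i - 1 + b"] by (simp add: algebra_simps)
    also have "\<dots> = \<theta> (int_iterate M \<theta> (i - 1) (int_iterate M \<theta> b \<omega>))"
      using int_iterate_succ[OF assms(1) sp[OF assms(2)], of "i - 1" b] step2 by simp
    finally show ?case
      using assms sp by (auto simp: mp_automorphism_def bij_betw_def dest!: inj_onD)
  qed
qed

section \<open>Sets with pairwise disjoint iterates\<close>

lemma standard_borel_countable_separating_family:
  assumes "standard_borel N"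
  shows "\<exists>C. countable C \<and> C \<subseteq> sets N \<and>
           (\<forall>x\<in>space N. \<forall>y\<in>space N. x \<noteq> y \<longrightarrow> (\<exists>B\<in>C. x \<in> B \<and> y \<notin> B))"
proof -
  obtain X where X: "topspace X = space N" "completely_metrizable_space X" "second_countable X"
      "sets N = sigma_sets (space N) {U. openin X U}"
    using assms by (auto simp: standard_borel_def)
  obtain C where C: "countable C" "\<forall>V\<in>C. openin X V"
      "\<forall>U x. openin X U \<and> x \<in> U \<longrightarrow> (\<exists>V\<in>C. x \<in> V \<and> V \<subseteq> U)"
    using X(3) by (auto simp: second_countable_def)
  have t1: "t1_space X"
    using X(2) by (simp add: completely_metrizable_imp_metrizable_space metrizable_imp_t1_space)
  have "\<exists>B\<in>C. x \<in> B \<and> y \<notin> B" if "x \<in> space N" "y \<in> space N" "x \<noteq> y" for x y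
  proof -
    have "\<exists>U. openin X U \<and> x \<in> U \<and> y \<notin> U"
      using t1 that by (simp add: t1_space_def X(1))
    then obtain U where "openin X U" "x \<in> U" "y \<notin> U" by blast
    then show ?thesis using C(3) by blast
  qed
  moreover have "C \<subseteq> sets N" using C(2) X(4) by auto
  ultimately show ?thesis using C(1) by blast
qed

lemma standard_prob_space_countable_separating_family:
  assumes "standard_prob_space M"
  shows "\<exists>C. countable C \<and> C \<subseteq> sets M \<and>
           (\<forall>x\<in>space M. \<forall>y\<in>space M. x \<noteq> y \<longrightarrow> (\<exists>B\<in>C. x \<in> B \<and> y \<notin> B))"
proof -
  obtain N where N: "standard_borel N" "M = N \<or> M = completion N"
    using assms by (auto simp: standard_prob_space_def)
  then have "space N = space M" "sets N \<subseteq> sets M"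
    by (auto simp: space_completion intro: sets_completionI_sets)
  with standard_borel_countable_separating_family[OF N(1)] show ?thesis
    by (metis (no_types, lifting) subset_trans)
qed

definition disjoint_iterates :: "'a measure \<Rightarrow> ('a \<Rightarrow> 'a) \<Rightarrow> int set \<Rightarrow> 'a set \<Rightarrow> bool" where
  "disjoint_iterates M \<theta> F A \<longleftrightarrow> (\<forall>a\<in>F. \<forall>b\<in>F. a \<noteq> b \<longrightarrow>
     (\<forall>x\<in>A. \<forall>y\<in>A. int_iterate M \<theta> a x \<noteq> int_iterate M \<theta> b y))"

text \<open>Points whose iterates are distinct have their iterates told apart by finitely many members of a
  countable separating family. All points told apart by the same choice of members form a set with
  disjoint iterates, and there are only countably many such choices.\<close>

lemma countable_cover_disjoint_iterates:
  assumes M: "standard_prob_space M" and \<theta>: "mp_automorphism M \<theta>"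
    and F: "finite F" "ae_distinct_iterates M \<theta> F"
  shows "\<exists>\<A>. countable \<A> \<and> \<A> \<subseteq> sets M \<and> (\<forall>A\<in>\<A>. disjoint_iterates M \<theta> F A) \<and>
           (AE \<omega> in M. \<exists>A\<in>\<A>. \<omega> \<in> A)"
proof -
  let ?it = "int_iterate M \<theta>"
  obtain C where C: "countable C" "C \<subseteq> sets M"
      and sep: "\<And>x y. x \<in> space M \<Longrightarrow> y \<in> space M \<Longrightarrow> x \<noteq> y \<Longrightarrow> \<exists>B\<in>C. x \<in> B \<and> y \<notin> B"
    using standard_prob_space_countable_separating_family[OF M] by metis
  define P where "P = {(a, b). a \<in> F \<and> b \<in> F \<and> a \<noteq> b}"
  have "P \<subseteq> F \<times> F" by (auto simp: P_def)
  then have P: "finite P" using F(1) by (simp add: finite_subset)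
  define K where
    "K \<beta> = {\<omega> \<in> space M. \<forall>p\<in>P. ?it (fst p) \<omega> \<in> \<beta> p \<and> ?it (snd p) \<omega> \<notin> \<beta> p}" for \<beta>
  have "K \<beta> \<in> sets M" if "\<beta> \<in> P \<rightarrow>\<^sub>E C" for \<beta>
    unfolding K_def
  proof (rule sets.sets_Collect_finite_All[OF _ P], goal_cases)
    case (1 p)
    have [measurable]: "\<beta> p \<in> sets M" using that 1 C(2) by auto
    have [measurable]: "?it n \<in> M \<rightarrow>\<^sub>M M" for n by (rule measurable_int_iterate[OF \<theta>])
    show ?case by measurable
  qed
  moreover have "disjoint_iterates M \<theta> F (K \<beta>)" for \<beta>
    unfolding disjoint_iterates_def
  proof (intro ballI impI)
    fix a b x y
    assume ab: "a \<in> F" "b \<in> F" "a \<noteq> b" and xy: "x \<in> K \<beta>" "y \<in> K \<beta>"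
    have "(a, b) \<in> P" using ab by (simp add: P_def)
    then have "?it a x \<in> \<beta> (a, b)" "?it b y \<notin> \<beta> (a, b)"
      using xy by (force simp: K_def)+
    then show "?it a x \<noteq> ?it b y" by metis
  qed
  moreover have "AE \<omega> in M. \<exists>A\<in>K ` (P \<rightarrow>\<^sub>E C). \<omega> \<in> A"
  proof -
    have "AE \<omega> in M. \<forall>p\<in>P. ?it (fst p) \<omega> \<noteq> ?it (snd p) \<omega>"
      using F(2) by (intro AE_finite_allI[OF P]) (auto simp: P_def ae_distinct_iterates_def)
    then show ?thesis
      using AE_space
    proof (eventually_elim, goal_cases)
      case (1 \<omega>)
      \<comment> \<open>the separating members chosen along the orbit of \<open>\<omega>\<close> are the index of its cell\<close>
      have "\<exists>B\<in>C. ?it (fst p) \<omega> \<in> B \<and> ?it (snd p) \<omega> \<notin> B" if "p \<in> P" for p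
        using 1 that sep measurable_space[OF measurable_int_iterate[OF \<theta>]] by auto
      then obtain \<beta> where \<beta>: "\<And>p. p \<in> P \<Longrightarrow> \<beta> p \<in> C \<and> ?it (fst p) \<omega> \<in> \<beta> p \<and> ?it (snd p) \<omega> \<notin> \<beta> p"
        by metis
      then have "\<omega> \<in> K (restrict \<beta> P)" "restrict \<beta> P \<in> P \<rightarrow>\<^sub>E C"
        using 1 by (auto simp: K_def)
      then show ?case by blast
    qed
  qed
  moreover have "countable (K ` (P \<rightarrow>\<^sub>E C))"
    using P C(1) by (intro countable_image countable_PiE) auto
  ultimately show ?thesis
    by (intro exI[of _ "K ` (P \<rightarrow>\<^sub>E C)"]) auto
qed

section \<open>Square-integrable functions\<close>

lemma L2_add:
  assumes "u \<in> L2 M" "v \<in> L2 M"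
  shows "(\<lambda>\<omega>. u \<omega> + v \<omega>) \<in> L2 M"
proof -
  have [measurable]: "u \<in> borel_measurable M" "v \<in> borel_measurable M"
    using assms by (auto simp: L2_def)
  have "(norm (u \<omega> + v \<omega>))\<^sup>2 \<le> 2 * (norm (u \<omega>))\<^sup>2 + 2 * (norm (v \<omega>))\<^sup>2" for \<omega>
  proof -
    have "(norm (u \<omega> + v \<omega>))\<^sup>2 \<le> (norm (u \<omega>) + norm (v \<omega>))\<^sup>2"
      by (intro power_mono norm_triangle_ineq) simp
    also have "\<dots> \<le> 2 * (norm (u \<omega>))\<^sup>2 + 2 * (norm (v \<omega>))\<^sup>2"
      using sum_squares_bound[of "norm (u \<omega>)" "norm (v \<omega>)"] by (simp add: power2_sum)
    finally show ?thesis .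
  qed
  then have "norm ((norm (u \<omega> + v \<omega>))\<^sup>2) \<le> norm (2 * (norm (u \<omega>))\<^sup>2 + 2 * (norm (v \<omega>))\<^sup>2)" for \<omega>
    by (simp add: abs_of_nonneg)
  note bound = this
  have int: "integrable M (\<lambda>\<omega>. 2 * (norm (u \<omega>))\<^sup>2 + 2 * (norm (v \<omega>))\<^sup>2)"
    using assms by (simp add: L2_def)
  have "integrable M (\<lambda>\<omega>. (norm (u \<omega> + v \<omega>))\<^sup>2)"
    by (rule Bochner_Integration.integrable_bound[OF int _ AE_I2[OF bound]]) measurable
  then show ?thesis by (simp add: L2_def)
qed

lemma L2_scaleR:
  assumes "u \<in> L2 M"
  shows "(\<lambda>\<omega>. c *\<^sub>R u \<omega>) \<in> L2 M"
  using assms by (auto simp: L2_def power_mult_distrib)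

lemma L2_diff:
  assumes "u \<in> L2 M" "v \<in> L2 M"
  shows "(\<lambda>\<omega>. u \<omega> - v \<omega>) \<in> L2 M"
  using L2_add[OF assms(1) L2_scaleR[OF assms(2), of "-1"]] by simp

lemma L2_sum:
  assumes "\<And>i. i \<in> I \<Longrightarrow> f i \<in> L2 M"
  shows "(\<lambda>\<omega>. \<Sum>i\<in>I. f i \<omega>) \<in> L2 M"
proof -
  have "(\<lambda>\<omega>. 0) \<in> L2 M" by (simp add: L2_def)
  with assms show ?thesis
    by (induction I rule: infinite_finite_induct) (auto intro: L2_add)
qed

lemma L2_indicator_scaleR:
  assumes "A \<in> sets M" "u \<in> L2 M"
  shows "(\<lambda>\<omega>. indicator A \<omega> *\<^sub>R u \<omega>) \<in> L2 M"
proof -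
  have "integrable M (\<lambda>\<omega>. indicator A \<omega> *\<^sub>R (norm (u \<omega>))\<^sup>2)"
    using assms by (intro integrable_mult_indicator) (auto simp: L2_def)
  moreover have "(\<lambda>\<omega>. (norm (indicator A \<omega> *\<^sub>R u \<omega>))\<^sup>2) = (\<lambda>\<omega>. indicator A \<omega> *\<^sub>R (norm (u \<omega>))\<^sup>2)"
    by (auto simp: indicator_def)
  moreover have "(\<lambda>\<omega>. indicator A \<omega> *\<^sub>R u \<omega>) \<in> borel_measurable M"
    using assms by (intro borel_measurable_scaleR borel_measurable_indicator) (auto simp: L2_def)
  ultimately show ?thesis by (simp add: L2_def)
qed

lemma L2_indicator_const:
  assumes "finite_measure M" "A \<in> sets M"
  shows "(\<lambda>\<omega>. indicator A \<omega> *\<^sub>R c) \<in> L2 M"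
proof -
  interpret finite_measure M by fact
  show ?thesis using assms(2) by (intro L2_indicator_scaleR) (auto simp: L2_def)
qed

lemma integrable_inner_L2:
  assumes "u \<in> L2 M" "v \<in> L2 M"
  shows "integrable M (\<lambda>\<omega>. u \<omega> \<bullet> v \<omega>)"
proof -
  have [measurable]: "u \<in> borel_measurable M" "v \<in> borel_measurable M"
    using assms by (auto simp: L2_def)
  have "norm (u \<omega> \<bullet> v \<omega>) \<le> norm ((norm (u \<omega>))\<^sup>2 + (norm (v \<omega>))\<^sup>2)" for \<omega>
  proof -
    have "\<bar>u \<omega> \<bullet> v \<omega>\<bar> \<le> norm (u \<omega>) * norm (v \<omega>)" by (rule Cauchy_Schwarz_ineq2)
    also have "\<dots> \<le> (norm (u \<omega>))\<^sup>2 + (norm (v \<omega>))\<^sup>2"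
      using sum_squares_bound[of "norm (u \<omega>)" "norm (v \<omega>)"]
        mult_nonneg_nonneg[OF norm_ge_zero[of "u \<omega>"] norm_ge_zero[of "v \<omega>"]] by linarith
    finally show ?thesis by simp
  qed
  note bound = this
  have int: "integrable M (\<lambda>\<omega>. (norm (u \<omega>))\<^sup>2 + (norm (v \<omega>))\<^sup>2)"
    using assms by (simp add: L2_def)
  show ?thesis
    by (rule Bochner_Integration.integrable_bound[OF int _ AE_I2[OF bound]]) measurable
qed

lemma L2_norm_scaleR: "L2_norm M (\<lambda>\<omega>. c *\<^sub>R v \<omega>) = \<bar>c\<bar> * L2_norm M v"
proof -
  have "(\<lambda>\<omega>. (c *\<^sub>R v \<omega>) \<bullet> (c *\<^sub>R v \<omega>)) = (\<lambda>\<omega>. c\<^sup>2 * (v \<omega> \<bullet> v \<omega>))"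
    by (simp add: power2_eq_square mult.assoc)
  then show ?thesis
    by (simp add: L2_norm_def L2_inner_def real_sqrt_mult)
qed

section \<open>Gradients\<close>

lemma L2_has_gradient_line_derivative:
  assumes grad: "L2_has_gradient M \<Psi> T" and u: "u \<in> L2 M" and v: "v \<in> L2 M"
  shows "((\<lambda>x. \<Psi> (\<lambda>\<omega>. u \<omega> + x *\<^sub>R v \<omega>)) has_real_derivative
           L2_inner M (T (\<lambda>\<omega>. u \<omega> + x *\<^sub>R v \<omega>)) v) (at x)"
proof -
  let ?w = "\<lambda>x \<omega>. u \<omega> + x *\<^sub>R v \<omega>"
  let ?N = "L2_norm M v"
  let ?D = "L2_inner M (T (?w x)) v"
  have w: "?w y \<in> L2 M" for y using u v by (intro L2_add L2_scaleR)
  have N: "?N \<ge> 0" by (simp add: L2_norm_def L2_inner_def integral_nonneg_AE)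
  have diff: "(\<lambda>\<omega>. ?w y \<omega> - ?w x \<omega>) = (\<lambda>\<omega>. (y - x) *\<^sub>R v \<omega>)" for y
    by (simp add: scaleR_diff_left)
  have inner: "L2_inner M f (\<lambda>\<omega>. (y - x) *\<^sub>R v \<omega>) = (y - x) * L2_inner M f v" for f y
    by (simp add: L2_inner_def)
  have "((\<lambda>y. \<Psi> (?w y)) has_derivative (\<lambda>y. y * ?D)) (at x)"
    unfolding has_derivative_at_alt
  proof (intro conjI allI impI)
    show "bounded_linear (\<lambda>y. y * ?D)" by (rule bounded_linear_mult_left)
    fix e :: real assume e: "0 < e"
    \<comment> \<open>the summand \<open>1\<close> keeps the denominator positive when \<open>v\<close> vanishes almost everywhere\<close>
    define e' where "e' = e / (?N + 1)"
    have e': "e' > 0" using e N by (simp add: e'_def)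
    obtain d where "d > 0 \<and> (\<forall>f\<in>L2 M. L2_norm M (\<lambda>\<omega>. f \<omega> - ?w x \<omega>) < d \<longrightarrow>
        \<bar>\<Psi> f - \<Psi> (?w x) - L2_inner M (T (?w x)) (\<lambda>\<omega>. f \<omega> - ?w x \<omega>)\<bar>
          \<le> e' * L2_norm M (\<lambda>\<omega>. f \<omega> - ?w x \<omega>))"
      by (rule grad[unfolded L2_has_gradient_def, THEN conjunct2, THEN conjunct2,
            THEN bspec, OF w, THEN spec, THEN mp, OF e', THEN exE])
    note d = this[THEN conjunct1] and dd = this[THEN conjunct2, THEN bspec, THEN mp]
    show "\<exists>\<delta>>0. \<forall>y. norm (y - x) < \<delta> \<longrightarrow>
        norm (\<Psi> (?w y) - \<Psi> (?w x) - (y - x) * ?D) \<le> e * norm (y - x)"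
    proof (intro exI[of _ "d / (?N + 1)"] conjI allI impI)
      show "0 < d / (?N + 1)" using d N by simp
      fix y assume y: "norm (y - x) < d / (?N + 1)"
      have "\<bar>y - x\<bar> * ?N \<le> \<bar>y - x\<bar> * (?N + 1)" by (intro mult_left_mono) auto
      also have "\<dots> < d" using y N by (simp add: field_simps)
      finally have "\<bar>\<Psi> (?w y) - \<Psi> (?w x) - (y - x) * ?D\<bar> \<le> e' * (\<bar>y - x\<bar> * ?N)"
        using dd[OF w[of y], unfolded diff inner L2_norm_scaleR] by simp
      also have "\<dots> \<le> e' * (\<bar>y - x\<bar> * (?N + 1))"
        using e' by (intro mult_left_mono) auto
      also have "\<dots> = e * \<bar>y - x\<bar>" using N by (simp add: e'_def)
      finally show "norm (\<Psi> (?w y) - \<Psi> (?w x) - (y - x) * ?D) \<le> e * norm (y - x)" by simp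
    qed
  qed
  then show ?thesis by (simp add: has_field_derivative_def mult.commute[of _ ?D] fun_eq_iff)
qed

text \<open>The mixed second difference of the potential can be computed along \<open>h\<close> or along \<open>g\<close>.
  The hypothesis makes it vanish when computed along \<open>h\<close>; its derivative along \<open>g\<close> is
  the difference of the two inner products in the conclusion. Working with differences avoids second
  derivatives of the potential, which need not exist.\<close>

lemma gradient_increment_orthogonal:
  assumes grad: "L2_has_gradient M \<Psi> T" and L2: "u \<in> L2 M" "h \<in> L2 M" "g \<in> L2 M"
    and stat: "\<And>\<epsilon> \<sigma>. AE \<omega> in M.
      T (\<lambda>\<omega>. (u \<omega> + \<epsilon> *\<^sub>R g \<omega>) + \<sigma> *\<^sub>R h \<omega>) \<omega> \<bullet> h \<omega> = T (\<lambda>\<omega>. u \<omega> + \<sigma> *\<^sub>R h \<omega>) \<omega> \<bullet> h \<omega>"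
  shows "L2_inner M (T (\<lambda>\<omega>. u \<omega> + h \<omega>)) g = L2_inner M (T u) g"
proof -
  let ?p = "\<lambda>\<epsilon> \<sigma> \<omega>. (u \<omega> + \<epsilon> *\<^sub>R g \<omega>) + \<sigma> *\<^sub>R h \<omega>"
  let ?q = "\<lambda>\<sigma> \<omega>. u \<omega> + \<sigma> *\<^sub>R h \<omega>"
  have const: "\<Psi> (?p \<epsilon> 1) - \<Psi> (?q 1) = \<Psi> (?p \<epsilon> 0) - \<Psi> (?q 0)" for \<epsilon>
  proof (rule DERIV_isconst_all[of "\<lambda>\<sigma>. \<Psi> (?p \<epsilon> \<sigma>) - \<Psi> (?q \<sigma>)" 1 0], intro allI)
    fix \<sigma>
    have "((\<lambda>\<sigma>. \<Psi> (?p \<epsilon> \<sigma>) - \<Psi> (?q \<sigma>)) has_real_derivative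
        L2_inner M (T (?p \<epsilon> \<sigma>)) h - L2_inner M (T (?q \<sigma>)) h) (at \<sigma>)"
      using L2 by (intro DERIV_diff L2_has_gradient_line_derivative[OF grad] L2_add L2_scaleR)
    moreover have "L2_inner M (T (?p \<epsilon> \<sigma>)) h = L2_inner M (T (?q \<sigma>)) h"
    proof -
      have "?p \<epsilon> \<sigma> \<in> L2 M" "?q \<sigma> \<in> L2 M" using L2 by (intro L2_add L2_scaleR; simp)+
      then have "T (?p \<epsilon> \<sigma>) \<in> L2 M" "T (?q \<sigma>) \<in> L2 M"
        using grad by (auto simp: L2_has_gradient_def L2_map_def)
      then show ?thesis
        unfolding L2_inner_def using stat[of \<epsilon> \<sigma>] L2(2)
        by (intro integral_cong_AE borel_measurable_integrable integrable_inner_L2)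
    qed
    ultimately show "((\<lambda>\<sigma>. \<Psi> (?p \<epsilon> \<sigma>) - \<Psi> (?q \<sigma>)) has_real_derivative 0) (at \<sigma>)" by simp
  qed
  let ?a = "\<lambda>\<epsilon> \<omega>. (u \<omega> + h \<omega>) + \<epsilon> *\<^sub>R g \<omega>"
  let ?b = "\<lambda>\<epsilon> \<omega>. u \<omega> + \<epsilon> *\<^sub>R g \<omega>"
  have "((\<lambda>\<epsilon>. \<Psi> (?a \<epsilon>) - \<Psi> (?b \<epsilon>)) has_real_derivative
      L2_inner M (T (?a 0)) g - L2_inner M (T (?b 0)) g) (at 0)"
    using L2 by (intro DERIV_diff L2_has_gradient_line_derivative[OF grad] L2_add)
  moreover have "\<Psi> (?a \<epsilon>) - \<Psi> (?b \<epsilon>) = \<Psi> (?q 1) - \<Psi> (?q 0)" for \<epsilon>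
    using const[of \<epsilon>] by (simp add: algebra_simps)
  ultimately have "((\<lambda>\<epsilon>::real. \<Psi> (?q 1) - \<Psi> (?q 0)) has_real_derivative
      L2_inner M (T (?a 0)) g - L2_inner M (T (?b 0)) g) (at 0)" by simp
  then have "L2_inner M (T (?a 0)) g - L2_inner M (T (?b 0)) g = 0"
    by (rule DERIV_unique[OF _ DERIV_const])
  then show ?thesis by simp
qed

section \<open>Locality of the memory\<close>

text \<open>Perturb along \<open>\<theta>\<^sup>k A\<close>, where \<open>A\<close> has disjoint iterates. On \<open>A\<close> only the \<open>k\<close>th argument of \<open>t\<close>
  is affected. Conversely, since \<open>-k\<close> is not a lag, no change of the input on \<open>A\<close> is seen
  by \<open>T\<close> on \<open>\<theta>\<^sup>k A\<close>. Symmetry, in the form of \<open>gradient_increment_orthogonal\<close>, then forces the increment of \<open>T\<close>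
  on \<open>A\<close> to be orthogonal to every test function carried by \<open>A\<close>, itself included.\<close>

lemma lag_independence_on_disjoint_iterates:
  fixes T :: "('a \<Rightarrow> 'h::{real_inner,banach,second_countable_topology}) \<Rightarrow> ('a \<Rightarrow> 'h)"
  assumes fin: "finite_measure M" and \<theta>: "mp_automorphism M \<theta>" and S: "finite S"
    and grad: "L2_has_gradient M \<Psi> T" and rep: "caratheodory_representation M \<theta> S T t"
    and k: "k \<in> S" "- k \<notin> S"
    and A: "A \<in> sets M" "disjoint_iterates M \<theta> (memory_iterates S) A"
    and z: "z \<in> S \<rightarrow>\<^sub>E UNIV"
  shows "AE \<omega> in M. \<omega> \<in> A \<longrightarrow> t \<omega> (z(k := d)) = t \<omega> z"
proof -
  let ?it = "int_iterate M \<theta>"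
  have sp: "?it n \<omega> \<in> space M" if "\<omega> \<in> space M" for n \<omega>
    using measurable_space[OF measurable_int_iterate[OF \<theta>] that] .
  have add: "?it a (?it b \<omega>) = ?it (a + b) \<omega>" if "\<omega> \<in> space M" for a b \<omega>
    using int_iterate_add[OF \<theta> that] by simp
  have zero: "?it 0 \<omega> = \<omega>" for \<omega> by (simp add: int_iterate_def)
  have AM: "\<omega> \<in> space M" if "\<omega> \<in> A" for \<omega> using A(1) that sets.sets_into_space by blast
  have disj: "?it a x \<noteq> ?it b y"
    if "a \<in> memory_iterates S" "b \<in> memory_iterates S" "a \<noteq> b" "x \<in> A" "y \<in> A" for a b x y
    using A(2) that by (auto simp: disjoint_iterates_def)

  \<comment> \<open>\<open>B s\<close> is \<open>\<theta>\<^sup>s A\<close>\<close>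
  define B where "B s = ?it (- s) -` A \<inter> space M" for s
  have B[measurable]: "B s \<in> sets M" for s
    unfolding B_def by (intro measurable_sets[OF measurable_int_iterate[OF \<theta>] A(1)])
  have B_iff: "?it s \<omega> \<in> B r \<longleftrightarrow> r = s" if "\<omega> \<in> A" "s \<in> S" "r \<in> S" for \<omega> s r
  proof
    assume "?it s \<omega> \<in> B r"
    then have "?it (- r) (?it s \<omega>) \<in> A" by (simp add: B_def)
    moreover have "?it r (?it (- r) (?it s \<omega>)) = ?it s \<omega>"
      using that(1) by (simp add: add sp AM zero)
    ultimately show "r = s"
      using disj[of r s _ \<omega>] that by (force simp: memory_iterates_def)
  next
    assume "r = s"
    then show "?it s \<omega> \<in> B r"
      using that(1) by (simp add: B_def add sp AM zero)
  qed
  have B_away: "?it s \<omega> \<notin> A" if "\<omega> \<in> B k" "s \<in> S" for \<omega> s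
  proof
    assume *: "?it s \<omega> \<in> A"
    have \<omega>: "\<omega> \<in> space M" "?it (- k) \<omega> \<in> A" using that(1) by (auto simp: B_def)
    have "?it (s + k) (?it (- k) \<omega>) = ?it 0 (?it s \<omega>)"
      using \<omega>(1) by (simp add: add zero)
    moreover have "s + k \<noteq> 0" using that(2) k(2) by (metis add.commute add_eq_0_iff)
    ultimately show False
      using disj[of "s + k" 0, OF _ _ _ \<omega>(2) *] that(2) k(1) by (auto simp: memory_iterates_def)
  qed

  define u where "u \<omega> = (\<Sum>s\<in>S. indicator (B s) \<omega> *\<^sub>R z s)" for \<omega>
  define h where "h \<omega> = indicator (B k) \<omega> *\<^sub>R (d - z k)" for \<omega>
  have uL: "u \<in> L2 M" unfolding u_def by (intro L2_sum L2_indicator_const fin B)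
  have hL: "h \<in> L2 M" unfolding h_def by (intro L2_indicator_const fin B)
  have uhL: "(\<lambda>\<omega>. u \<omega> + h \<omega>) \<in> L2 M" using uL hL by (rule L2_add)
  have TL: "T f \<in> L2 M" if "f \<in> L2 M" for f
    using grad that by (auto simp: L2_has_gradient_def L2_map_def)
  define \<Delta> where "\<Delta> \<omega> = T (\<lambda>\<omega>. u \<omega> + h \<omega>) \<omega> - T u \<omega>" for \<omega>
  define g where "g \<omega> = indicator A \<omega> *\<^sub>R \<Delta> \<omega>" for \<omega>
  have \<Delta>L: "\<Delta> \<in> L2 M" unfolding \<Delta>_def by (intro L2_diff TL uhL uL)
  have gL: "g \<in> L2 M" unfolding g_def by (intro L2_indicator_scaleR A \<Delta>L)
  have rep': "AE \<omega> in M. T f \<omega> = t \<omega> (\<lambda>s\<in>S. f (?it s \<omega>))" if "f \<in> L2 M" for f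
    using rep that by (simp add: caratheodory_representation_def)

  have "AE \<omega> in M. T (\<lambda>\<omega>. (u \<omega> + \<epsilon> *\<^sub>R g \<omega>) + \<sigma> *\<^sub>R h \<omega>) \<omega> \<bullet> h \<omega> = T (\<lambda>\<omega>. u \<omega> + \<sigma> *\<^sub>R h \<omega>) \<omega> \<bullet> h \<omega>"
    for \<epsilon> \<sigma>
  proof -
    have "(\<lambda>\<omega>. (u \<omega> + \<epsilon> *\<^sub>R g \<omega>) + \<sigma> *\<^sub>R h \<omega>) \<in> L2 M" "(\<lambda>\<omega>. u \<omega> + \<sigma> *\<^sub>R h \<omega>) \<in> L2 M"
      by (intro L2_add L2_scaleR uL gL hL)+
    from this[THEN rep'] show ?thesis
    proof (eventually_elim, goal_cases)
      case (1 \<omega>)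
      show ?case
      proof (cases "\<omega> \<in> B k")
        case True
        have "g (?it s \<omega>) = 0" if "s \<in> S" for s
          using B_away[OF True that] by (simp add: g_def)
        then have "(\<lambda>s\<in>S. (u (?it s \<omega>) + \<epsilon> *\<^sub>R g (?it s \<omega>)) + \<sigma> *\<^sub>R h (?it s \<omega>))
                     = (\<lambda>s\<in>S. u (?it s \<omega>) + \<sigma> *\<^sub>R h (?it s \<omega>))"
          by (intro restrict_ext) simp
        then show ?thesis using 1 by simp
      qed (simp add: h_def)
    qed
  qed
  then have "L2_inner M (T (\<lambda>\<omega>. u \<omega> + h \<omega>)) g = L2_inner M (T u) g"
    by (rule gradient_increment_orthogonal[OF grad uL hL gL])
  then have "0 = (\<integral>\<omega>. T (\<lambda>\<omega>. u \<omega> + h \<omega>) \<omega> \<bullet> g \<omega> - T u \<omega> \<bullet> g \<omega> \<partial>M)"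
    by (simp add: L2_inner_def integrable_inner_L2 TL uhL uL gL)
  also have "\<dots> = (\<integral>\<omega>. g \<omega> \<bullet> g \<omega> \<partial>M)"
    by (intro Bochner_Integration.integral_cong)
       (auto simp: g_def \<Delta>_def inner_diff_left indicator_def)
  finally have "AE \<omega> in M. g \<omega> \<bullet> g \<omega> = 0"
    using integral_nonneg_eq_0_iff_AE[OF integrable_inner_L2[OF gL gL]] by simp
  with rep'[OF uhL] rep'[OF uL] show ?thesis
  proof eventually_elim
    case (elim \<omega>)
    show ?case
    proof
      assume \<omega>: "\<omega> \<in> A"
      have u: "u (?it s \<omega>) = z s" if "s \<in> S" for s
      proof -
        have "u (?it s \<omega>) = (\<Sum>r\<in>S. if r = s then z r else 0)"
          unfolding u_def using that by (intro sum.cong) (auto simp: indicator_def B_iff[OF \<omega>])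
        then show ?thesis using S that by simp
      qed
      have h: "h (?it s \<omega>) = (if s = k then d - z k else 0)" if "s \<in> S" for s
        using that k(1) by (auto simp: h_def indicator_def B_iff[OF \<omega>])
      have "(\<lambda>s\<in>S. u (?it s \<omega>)) = z"
        using z u by (auto simp: fun_eq_iff PiE_def extensional_def)
      moreover have "(\<lambda>s\<in>S. u (?it s \<omega>) + h (?it s \<omega>)) = z(k := d)"
        using z u h k(1) by (auto simp: fun_eq_iff PiE_def extensional_def)
      ultimately show "t \<omega> (z(k := d)) = t \<omega> z"
        using elim \<omega> by (simp add: g_def \<Delta>_def)
    qed
  qed
qed

lemma continuous_map_product_eq_if_dense:
  fixes f :: "('i \<Rightarrow> 'h::{first_countable_topology}) \<Rightarrow> 'c::t2_space"
  assumes cont: "continuous_map (product_topology (\<lambda>_. euclidean) S) euclidean f"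
    and k: "k \<in> S" and D: "closure D = UNIV"
    and eq: "\<And>z d. z \<in> S \<rightarrow>\<^sub>E D \<Longrightarrow> d \<in> D \<Longrightarrow> f (z(k := d)) = f z"
    and z: "z \<in> S \<rightarrow>\<^sub>E UNIV"
  shows "f (z(k := d)) = f z"
proof -
  have "\<exists>x. (\<forall>n. x n \<in> D) \<and> x \<longlonglongrightarrow> l" for l
    using D closure_sequential[of l D] by auto
  then obtain X where X: "\<And>l n. X l n \<in> D" "\<And>l. X l \<longlonglongrightarrow> l" by metis
  define Z where "Z n = (\<lambda>s\<in>S. X (z s) n)" for n :: nat
  have Z: "Z n \<in> S \<rightarrow>\<^sub>E D" for n using X by (auto simp: Z_def)
  have "limitin (product_topology (\<lambda>_. euclidean) S) Z z sequentially"
    using z X by (auto simp: limitin_componentwise Z_def PiE_def)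
  from continuous_map_limit[OF cont this] have 1: "(\<lambda>n. f (Z n)) \<longlonglongrightarrow> f z"
    by (simp add: o_def)
  have "limitin (product_topology (\<lambda>_. euclidean) S) (\<lambda>n. (Z n)(k := X d n)) (z(k := d)) sequentially"
    using z X k by (auto simp: limitin_componentwise Z_def PiE_def extensional_def)
  from continuous_map_limit[OF cont this] have "(\<lambda>n. f ((Z n)(k := X d n))) \<longlonglongrightarrow> f (z(k := d))"
    by (simp add: o_def)
  then have "(\<lambda>n. f (Z n)) \<longlonglongrightarrow> f (z(k := d))"
    by (simp add: eq[OF Z X(1)])
  from LIMSEQ_unique[OF this 1] show ?thesis .
qed

text \<open>The exceptional null set in \<open>lag_independence_on_disjoint_iterates\<close> depends on \<open>A\<close>, \<open>z\<close> and \<open>d\<close>. A countable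
  cover and a countable dense set of arguments reduce these to countably many.\<close>

lemma gradient_lag_inactive:
  fixes T :: "('a \<Rightarrow> 'h::{real_inner,banach,second_countable_topology}) \<Rightarrow> ('a \<Rightarrow> 'h)"
  assumes M: "standard_prob_space M" and \<theta>: "mp_automorphism M \<theta>" and S: "finite S"
    and F: "ae_distinct_iterates M \<theta> (memory_iterates S)"
    and grad: "L2_has_gradient M \<Psi> T" and rep: "caratheodory_representation M \<theta> S T t"
    and k: "k \<in> S" "- k \<notin> S"
  shows "inactive_lag M S t k"
proof -
  have "prob_space M" using M by (simp add: standard_prob_space_def)
  then have fin: "finite_measure M" by (rule prob_space.finite_measure)
  have "memory_iterates S = {0} \<union> S \<union> (\<lambda>(a, b). a + b) ` (S \<times> S)"
    by (auto simp: memory_iterates_def)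
  then have finF: "finite (memory_iterates S)" using S by simp
  obtain \<A> where \<A>: "countable \<A>" "\<A> \<subseteq> sets M"
      "\<And>A. A \<in> \<A> \<Longrightarrow> disjoint_iterates M \<theta> (memory_iterates S) A"
      "AE \<omega> in M. \<exists>A\<in>\<A>. \<omega> \<in> A"
    using countable_cover_disjoint_iterates[OF M \<theta> finF F] by blast
  obtain D :: "'h set" where D: "countable D" "\<And>X. open X \<Longrightarrow> X \<noteq> {} \<Longrightarrow> \<exists>d\<in>D. d \<in> X"
    using countable_dense_exists[where ?'a = 'h] by blast
  have dense: "closure D = UNIV"
    using D(2)[of "- closure D"] closure_subset[of D] by auto
  have "AE \<omega> in M. \<forall>A\<in>\<A>. \<forall>z\<in>S \<rightarrow>\<^sub>E D. \<forall>d\<in>D. \<omega> \<in> A \<longrightarrow> t \<omega> (z(k := d)) = t \<omega> z"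
    using \<A> D(1) S
    by (intro AE_ball_countable' lag_independence_on_disjoint_iterates[OF fin \<theta> S grad rep k]
          countable_PiE) auto
  moreover have "AE \<omega> in M. continuous_map (product_topology (\<lambda>_. euclidean) S) euclidean (t \<omega>)"
    using rep by (simp add: caratheodory_representation_def)
  ultimately show ?thesis
    unfolding inactive_lag_def using \<A>(4)
  proof eventually_elim
    case (elim \<omega>)
    then obtain A where "A \<in> \<A>" "\<omega> \<in> A" by blast
    then have eq: "t \<omega> (z(k := d)) = t \<omega> z" if "z \<in> S \<rightarrow>\<^sub>E D" "d \<in> D" for z d
      using elim(1) that by blast
    show ?case
      by (intro ballI allI continuous_map_product_eq_if_dense[OF elim(2) k(1) dense eq])
  qed
qed

section \<open>Reduction to a pointwise map\<close>

text \<open>Approximating the identity by simple functions exhibits the Caratheodory function as a pointwise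
  limit of functions each of which uses only finitely many of the measurable sections \<open>\<omega> \<mapsto> f \<omega> z\<close>.\<close>

lemma measurable_caratheodory_function:
  fixes f :: "'a \<Rightarrow> 'h::{metric_space,second_countable_topology} \<Rightarrow> 'c::metric_space"
  assumes meas: "\<And>z. (\<lambda>\<omega>. f \<omega> z) \<in> borel_measurable M"
    and cont: "\<And>\<omega>. continuous_on UNIV (f \<omega>)"
  shows "(\<lambda>(\<omega>, z). f \<omega> z) \<in> M \<Otimes>\<^sub>M borel \<rightarrow>\<^sub>M borel"
proof -
  obtain F :: "nat \<Rightarrow> 'h \<Rightarrow> 'h" where F: "\<And>i. simple_function borel (F i)" "\<And>z. (\<lambda>i. F i z) \<longlonglongrightarrow> z"
    using borel_measurable_implies_sequence_metric[of "\<lambda>z::'h. z" borel undefined, simplified]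
    by metis
  show ?thesis
  proof (rule borel_measurable_LIMSEQ_metric)
    fix i
    have fin: "finite (range (F i))"
      using F(1)[of i] by (simp add: simple_function_def)
    have "(\<lambda>p. F i (snd p)) \<in> M \<Otimes>\<^sub>M borel \<rightarrow>\<^sub>M count_space UNIV"
      by (rule measurable_compose[OF measurable_snd measurable_simple_function[OF F(1)]])
    then have "(\<lambda>p. F i (snd p)) \<in> M \<Otimes>\<^sub>M borel \<rightarrow>\<^sub>M count_space (range (F i))"
      using fin by (auto simp: measurable_count_space_eq2 intro: measurable_sets)
    then show "(\<lambda>p. f (fst p) (F i (snd p))) \<in> M \<Otimes>\<^sub>M borel \<rightarrow>\<^sub>M borel"
      by (rule measurable_compose_countable'[where f = "\<lambda>z p. f (fst p) z", rotated])
         (auto intro: countable_finite[OF fin] measurable_compose[OF measurable_fst meas])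
  next
    fix p :: "'a \<times> 'h"
    show "(\<lambda>i. f (fst p) (F i (snd p))) \<longlonglongrightarrow> (case p of (\<omega>, z) \<Rightarrow> f \<omega> z)"
      using continuous_on_tendsto_compose[OF cont F(2)] by (auto simp: case_prod_beta)
  qed
qed

lemma eq_if_coordinatewise_independent:
  assumes "finite K" "K \<subseteq> S"
    and "\<And>k z h. k \<in> K \<Longrightarrow> z \<in> S \<rightarrow>\<^sub>E UNIV \<Longrightarrow> f (z(k := h)) = f z"
    and "z \<in> S \<rightarrow>\<^sub>E UNIV"
  shows "f (\<lambda>s. if s \<in> K then y s else z s) = f z"
  using assms
proof (induction K rule: finite_induct)
  case (insert k K)
  let ?w = "\<lambda>s. if s \<in> K then y s else z s"
  have "?w \<in> S \<rightarrow>\<^sub>E UNIV" using insert.prems by (auto simp: PiE_def extensional_def)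
  then have "f (?w(k := y k)) = f ?w" using insert.prems(2) by blast
  moreover have "?w(k := y k) = (\<lambda>s. if s \<in> insert k K then y s else z s)" by auto
  ultimately show ?case using insert by simp
qed simp

lemma pointwise_representation_if_lags_inactive:
  fixes T :: "('a \<Rightarrow> 'h::{real_inner,banach,second_countable_topology}) \<Rightarrow> ('a \<Rightarrow> 'h)"
  assumes S: "finite S" "0 \<in> S" and rep: "caratheodory_representation M \<theta> S T t"
    and inactive: "\<And>k. k \<in> S \<Longrightarrow> k \<noteq> 0 \<Longrightarrow> inactive_lag M S t k"
  shows "\<exists>s :: 'a \<Rightarrow> 'h \<Rightarrow> 'h. (\<lambda>(\<omega>, z). s \<omega> z) \<in> M \<Otimes>\<^sub>M borel \<rightarrow>\<^sub>M borel \<and>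
           (\<forall>u\<in>L2 M. AE \<omega> in M. T u \<omega> = s \<omega> (u \<omega>))"
proof -
  let ?X = "product_topology (\<lambda>_. euclidean :: 'h topology) S"
  let ?e = "\<lambda>z. \<lambda>s\<in>S. if s = 0 then z else 0 :: 'h"
  have "AE \<omega> in M. continuous_map ?X euclidean (t \<omega>)"
    using rep by (simp add: caratheodory_representation_def)
  then obtain N where N: "{\<omega>\<in>space M. \<not> continuous_map ?X euclidean (t \<omega>)} \<subseteq> N" "N \<in> null_sets M"
    by (auto elim!: AE_E simp: null_sets_def)
  \<comment> \<open>the value \<open>0\<close> on the exceptional null set and off the space makes every section continuous\<close>
  define s where "s \<omega> z = (if \<omega> \<in> space M - N then t \<omega> (?e z) else 0)" for \<omega> z
  have "continuous_on UNIV (s \<omega>)" for \<omega>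
  proof (cases "\<omega> \<in> space M - N")
    case True
    then have "continuous_map ?X euclidean (t \<omega>)" using N(1) by auto
    moreover have "continuous_map euclidean ?X ?e"
      by (auto simp: continuous_map_componentwise)
    ultimately have "continuous_map euclidean euclidean (t \<omega> \<circ> ?e)"
      by (rule continuous_map_compose[rotated])
    moreover have "t \<omega> \<circ> ?e = s \<omega>" using True by (auto simp: s_def)
    ultimately show ?thesis by simp
  next
    case False
    then have "s \<omega> = (\<lambda>_. 0)" by (auto simp: s_def)
    then show ?thesis by simp
  qed
  moreover have "(\<lambda>\<omega>. s \<omega> z) \<in> borel_measurable M" for z
  proof -
    have [measurable]: "(\<lambda>\<omega>. t \<omega> (?e z)) \<in> borel_measurable M"
      using rep by (auto simp: caratheodory_representation_def)
    have [measurable]: "N \<in> sets M" using N(2) by auto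
    show ?thesis unfolding s_def by measurable
  qed
  ultimately have "(\<lambda>(\<omega>, z). s \<omega> z) \<in> M \<Otimes>\<^sub>M borel \<rightarrow>\<^sub>M borel"
    by (rule measurable_caratheodory_function[rotated])
  moreover have "AE \<omega> in M. T u \<omega> = s \<omega> (u \<omega>)" if u: "u \<in> L2 M" for u
  proof -
    have "AE \<omega> in M. T u \<omega> = t \<omega> (\<lambda>s\<in>S. u (int_iterate M \<theta> s \<omega>))"
      using rep u by (simp add: caratheodory_representation_def)
    moreover have "AE \<omega> in M. \<forall>k\<in>S - {0}. \<forall>z\<in>S \<rightarrow>\<^sub>E UNIV. \<forall>h. t \<omega> (z(k := h)) = t \<omega> z"
      using inactive S(1) by (intro AE_finite_allI[of "S - {0}"]) (auto simp: inactive_lag_def)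
    ultimately show ?thesis
      using AE_not_in[OF N(2)] AE_space
    proof (eventually_elim, goal_cases)
      case (1 \<omega>)
      let ?z = "\<lambda>s\<in>S. u (int_iterate M \<theta> s \<omega>)"
      have "t \<omega> (\<lambda>s. if s \<in> S - {0} then 0 else ?z s) = t \<omega> ?z"
        using S(1) by (intro eq_if_coordinatewise_independent[where S = S] 1(2)[rule_format]) auto
      moreover have "(\<lambda>s. if s \<in> S - {0} then 0 else ?z s) = ?e (u \<omega>)"
        using S(2) by (auto simp: fun_eq_iff int_iterate_def)
      ultimately show ?case using 1 by (simp add: s_def)
    qed
  qed
  ultimately show ?thesis by blast
qed

section \<open>Memory sets that meet their negatives at most in zero\<close>

theorem corollary6p3:
  fixes M :: "'a measure" and \<theta> :: "'a \<Rightarrow> 'a"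
  assumes "standard_prob_space M"
    and "mp_automorphism M \<theta>"
  shows "(\<forall>S (T :: ('a \<Rightarrow> 'h::{real_inner,banach,second_countable_topology}) \<Rightarrow> ('a \<Rightarrow> 'h)) \<Psi>.
            finite S \<and>
            ae_distinct_iterates M \<theta> (memory_iterates S) \<and>
            finite_memory_map M \<theta> S T \<and>
            L2_C1 M \<Psi> \<and> L2_has_gradient M \<Psi> T \<and>
            S \<inter> uminus ` S \<subseteq> {0}
            \<longrightarrow> (\<forall>t. caratheodory_representation M \<theta> S T t \<longrightarrow>
                   (\<forall>k\<in>S. k \<noteq> 0 \<longrightarrow> inactive_lag M S t k)))
       \<and> (\<forall>(m::nat) (T :: ('a \<Rightarrow> 'h) \<Rightarrow> ('a \<Rightarrow> 'h)) \<Psi>.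
            ae_distinct_iterates M \<theta> {0..2 * int m} \<and>
            finite_memory_map M \<theta> {0..int m} T \<and>
            L2_C1 M \<Psi> \<and> L2_has_gradient M \<Psi> T
            \<longrightarrow> (\<exists>s :: 'a \<Rightarrow> 'h \<Rightarrow> 'h.
                   (\<lambda>(\<omega>, z). s \<omega> z) \<in> M \<Otimes>\<^sub>M borel \<rightarrow>\<^sub>M borel \<and>
                   (\<forall>u\<in>L2 M. AE \<omega> in M. T u \<omega> = s \<omega> (u \<omega>))))"
proof -
  have inactive: "inactive_lag M S t k"
    if "finite S" "ae_distinct_iterates M \<theta> (memory_iterates S)" "L2_has_gradient M \<Psi> T"
      "S \<inter> uminus ` S \<subseteq> {0}" "caratheodory_representation M \<theta> S T t" "k \<in> S" "k \<noteq> 0"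
    for S and T :: "('a \<Rightarrow> 'h) \<Rightarrow> ('a \<Rightarrow> 'h)" and \<Psi> t k
  proof -
    have "- k \<notin> S"
    proof
      assume "- k \<in> S"
      then have "k \<in> S \<inter> uminus ` S" using that(6) by (auto intro: rev_image_eqI)
      then show False using that(4,7) by blast
    qed
    then show ?thesis
      using gradient_lag_inactive[OF assms that(1,2,3,5,6)] by simp
  qed
  show ?thesis
  proof (intro conjI allI impI ballI, goal_cases)
    case (1 S T \<Psi> t k)
    then show ?case using inactive[of S \<Psi> T t k] by blast
  next
    case (2 m T \<Psi>)
    have "memory_iterates {0..int m} = {0..2 * int m}"
    proof
      show "memory_iterates {0..int m} \<subseteq> {0..2 * int m}" by (auto simp: memory_iterates_def)
      show "{0..2 * int m} \<subseteq> memory_iterates {0..int m}"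
      proof
        fix n assume n: "n \<in> {0..2 * int m}"
        have "n = min n (int m) + (n - min n (int m))" by simp
        moreover have "min n (int m) \<in> {0..int m}" "n - min n (int m) \<in> {0..int m}"
          using n by auto
        ultimately show "n \<in> memory_iterates {0..int m}"
          unfolding memory_iterates_def by blast
      qed
    qed
    with 2 obtain t where "caratheodory_representation M \<theta> {0..int m} T t"
        "ae_distinct_iterates M \<theta> (memory_iterates {0..int m})" "L2_has_gradient M \<Psi> T"
      by (auto simp: finite_memory_map_def)
    then show ?case
      by (intro pointwise_representation_if_lags_inactive[of "{0..int m}" M \<theta> T t] inactive) auto
  qed
qed

end
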